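(* Let $a_n$ be the number of staircase diagrams on the path graph $A_n$ ($a_0=1$), $\overline a_n$ the number of fully supported ones, $A(t)=\sum_{n\ge0}a_nt^n$ and $\overline A(t)=\sum_{n\ge1}\overline a_nt^n$. Then $$A(t)=\frac{1+\overline A(t)}{1-t-t\overline A(t)}.$$
   Context: Path graph $A_n$: vertices $s_1,\dots,s_n$, $s_i\sim s_{i+1}$. A staircase diagram is a poset $(\mathcal D,\preceq)$ of nonempty subsets (blocks) of the vertex set $S$ (the empty diagram included) with: (1) each block connected, and if $B$ covers $B'$ then $B\cup B'$ connected; (2) $\mathcal D_s=\{B:s\in B\}$ a chain; (3) if $s\sim t$, $\mathcal D_s\cup\mathcal D_t$ a chain in which $\mathcal D_s,\mathcal D_t$ are saturated; (4) each $B$ is the minimum of some $\mathcal D_s$ and maximum of some $\mathcal D_{s'}$. Fully supported means $\bigcup_B B=S$. *)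

theory Defs
  imports
    "Graph_Theory.Pair_Digraph"
    "Graph_Theory.Digraph_Component"
    "HOL-Computational_Algebra.Formal_Power_Series"
begin

text \<open>An undirected graph is a symmetric \<^typ>\<open>'a pair_pre_digraph\<close>. A vertex subset is connected
  if it induces a connected subgraph (which, for \<^const>\<open>Digraph_Component.connected\<close>,
  excludes the empty set).\<close>

definition connected_subset :: "'a pair_pre_digraph \<Rightarrow> 'a set \<Rightarrow> bool" where
  "connected_subset G B \<longleftrightarrow> Digraph_Component.connected (with_proj G \<restriction> B)"

text \<open>A poset is a pair \<open>(D, R)\<close>, where \<open>(B', B) \<in> R\<close> means \<open>B' \<preceq> B\<close>. Since
  \<^const>\<open>partial_order_on\<close> includes \<open>R \<subseteq> D \<times> D\<close>, distinct pairs are distinct posets.\<close>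

definition strictly_below :: "'b rel \<Rightarrow> 'b \<Rightarrow> 'b \<Rightarrow> bool" where
  "strictly_below R x y \<longleftrightarrow> (x, y) \<in> R \<and> x \<noteq> y"

definition covers :: "'b set \<Rightarrow> 'b rel \<Rightarrow> 'b \<Rightarrow> 'b \<Rightarrow> bool" where
  "covers D R y x \<longleftrightarrow> x \<in> D \<and> y \<in> D \<and> strictly_below R x y \<and>
     \<not> (\<exists>z\<in>D. strictly_below R x z \<and> strictly_below R z y)"

text \<open>A subchain \<open>C\<close> of a chain \<open>P\<close> is saturated if no element of \<open>P\<close> outside \<open>C\<close> lies strictly
  between two elements of \<open>C\<close>.\<close>

definition saturated_in :: "'b rel \<Rightarrow> 'b set \<Rightarrow> 'b set \<Rightarrow> bool" where
  "saturated_in R P C \<longleftrightarrow> C \<subseteq> P \<and>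
     \<not> (\<exists>x\<in>C. \<exists>y\<in>C. \<exists>z\<in>P - C. strictly_below R x z \<and> strictly_below R z y)"

definition is_minimum :: "'b rel \<Rightarrow> 'b set \<Rightarrow> 'b \<Rightarrow> bool" where
  "is_minimum R C b \<longleftrightarrow> b \<in> C \<and> (\<forall>c\<in>C. (b, c) \<in> R)"

definition is_maximum :: "'b rel \<Rightarrow> 'b set \<Rightarrow> 'b \<Rightarrow> bool" where
  "is_maximum R C b \<longleftrightarrow> b \<in> C \<and> (\<forall>c\<in>C. (c, b) \<in> R)"

definition blocks_at :: "'a set set \<Rightarrow> 'a \<Rightarrow> 'a set set" where
  "blocks_at D s = {B \<in> D. s \<in> B}"

definition staircase_diagram :: "'a pair_pre_digraph \<Rightarrow> 'a set set \<Rightarrow> 'a set rel \<Rightarrow> bool" where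
  "staircase_diagram G D R \<longleftrightarrow>
     (\<forall>B\<in>D. B \<noteq> {} \<and> B \<subseteq> pverts G) \<and>
     partial_order_on D R \<and>
     (\<forall>B\<in>D. connected_subset G B) \<and>
     (\<forall>B B'. covers D R B B' \<longrightarrow> connected_subset G (B \<union> B')) \<and>
     (\<forall>s\<in>pverts G. blocks_at D s \<in> Chains R) \<and>
     (\<forall>(s, t)\<in>parcs G.
        blocks_at D s \<union> blocks_at D t \<in> Chains R \<and>
        saturated_in R (blocks_at D s \<union> blocks_at D t) (blocks_at D s) \<and>
        saturated_in R (blocks_at D s \<union> blocks_at D t) (blocks_at D t)) \<and>
     (\<forall>B\<in>D. (\<exists>s\<in>pverts G. is_minimum R (blocks_at D s) B) \<and>
             (\<exists>s'\<in>pverts G. is_maximum R (blocks_at D s') B))"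

definition fully_supported :: "'a pair_pre_digraph \<Rightarrow> 'a set set \<Rightarrow> bool" where
  "fully_supported G D \<longleftrightarrow> \<Union>D = pverts G"

definition path_graph :: "nat \<Rightarrow> nat pair_pre_digraph" where
  "path_graph n = \<lparr> pverts = {1..n},
     parcs = {(i, j). i \<in> {1..n} \<and> j \<in> {1..n} \<and> (j = Suc i \<or> i = Suc j)} \<rparr>"

definition num_staircase :: "nat \<Rightarrow> nat" where
  "num_staircase n = card {(D, R). staircase_diagram (path_graph n) D R}"

definition num_full_staircase :: "nat \<Rightarrow> nat" where
  "num_full_staircase n =
     card {(D, R). staircase_diagram (path_graph n) D R \<and> fully_supported (path_graph n) D}"

definition staircase_gf :: "rat fps" where
  "staircase_gf = Abs_fps (\<lambda>n. of_nat (num_staircase n))"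

text \<open>The constant term is 0: the sum over fully supported diagrams starts at \<open>n = 1\<close>.\<close>

definition full_staircase_gf :: "rat fps" where
  "full_staircase_gf = Abs_fps (\<lambda>n. if n = 0 then 0 else of_nat (num_full_staircase n))"

text \<open>The sets being counted are finite, so that \<^const>\<open>card\<close> is the actual number of diagrams.\<close>

lemma finite_staircase_diagrams:
  assumes "finite (pverts G)"
  shows "finite {(D, R). staircase_diagram G D R}"
proof (rule finite_subset)
  let ?P = "Pow (pverts G)"
  show "{(D, R). staircase_diagram G D R} \<subseteq> Pow ?P \<times> Pow (?P \<times> ?P)"
    unfolding staircase_diagram_def partial_order_on_def preorder_on_def by blast
  show "finite (Pow ?P \<times> Pow (?P \<times> ?P))"
    using assms by simp
qed

lemma num_staircase_0: "num_staircase 0 = 1"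
proof -
  have "{(D, R). staircase_diagram (path_graph 0) D R} = {({}, {})}"
    by (fastforce simp: staircase_diagram_def path_graph_def partial_order_on_def preorder_on_def
        refl_on_def trans_def antisym_def covers_def)
  then show ?thesis by (simp add: num_staircase_def)
qed

end

theory Submission
  imports Defs
begin

text \<open>Let \<open>k + 1\<close> be the first vertex that a diagram on the path with \<open>n\<close> vertices leaves uncovered.
  Every block lies on one side of \<open>k + 1\<close>, and so does the union of a block with one that it covers.
  Since a finite order is generated by its covering relation, no block on the left is comparable with
  one on the right. The diagram is therefore the disjoint union of a fully supported diagram on \<open>k\<close>
  vertices and an arbitrary one on \<open>n - k - 1\<close> vertices, with no further compatibility condition.
  Hence \<open>A = F + t F A\<close>, where \<open>F\<close> is the series of fully supported diagrams with the empty diagram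
  on zero vertices included.\<close>

section \<open>Connectivity of vertex sets without walks\<close>

text \<open>A nonempty set is connected iff it is the only nonempty part of itself that no arc
  inside it enters or leaves. This criterion mentions only the arcs between elements of
  \<open>B\<close>, so restriction and relabelling of the graph become rewriting. The equivalence
  under the arc is symmetric in both ends and thus matches the symmetrised relation
  \<open>E\<close>.\<close>

lemma connected_subset_iff:
  "connected_subset G B \<longleftrightarrow> B \<noteq> {} \<and>
     (\<forall>U\<subseteq>B. U \<noteq> {} \<longrightarrow> (\<forall>x\<in>B. \<forall>y\<in>B. (x, y) \<in> parcs G \<longrightarrow> (x \<in> U \<longleftrightarrow> y \<in> U)) \<longrightarrow> U = B)"
proof -
  define E where "E = {(x, y). x \<in> B \<and> y \<in> B \<and> ((x, y) \<in> parcs G \<or> (y, x) \<in> parcs G)}"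
  have conn: "connected_subset G B \<longleftrightarrow> B \<noteq> {} \<and> (\<forall>u\<in>B. \<forall>v\<in>B. (u, v) \<in> rtrancl_on B E)"
  proof -
    have "parcs (mk_symmetric (with_proj G \<restriction> B)) = E"
      by (auto simp: mk_symmetric_def E_def induce_subgraph_def)
    then show ?thesis
      by (simp add: connected_subset_def connected_def strongly_connected_def reachable_def
          arcs_ends_def arc_to_ends_def)
  qed
  have reach: "\<forall>u\<in>B. \<forall>v\<in>B. (u, v) \<in> rtrancl_on B E"
    if *: "\<And>U. U \<subseteq> B \<Longrightarrow> U \<noteq> {} \<Longrightarrow>
      \<forall>x\<in>B. \<forall>y\<in>B. (x, y) \<in> parcs G \<longrightarrow> (x \<in> U \<longleftrightarrow> y \<in> U) \<Longrightarrow> U = B"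
  proof
    fix u assume u: "u \<in> B"
    \<comment> \<open>The criterion is applied to the component of \<open>u\<close>.\<close>
    have "{v. (u, v) \<in> rtrancl_on B E} = B"
    proof (rule *)
      show "{v. (u, v) \<in> rtrancl_on B E} \<subseteq> B" by (auto dest: in_rtrancl_on_in_F)
      show "{v. (u, v) \<in> rtrancl_on B E} \<noteq> {}" using u by auto
      show "\<forall>x\<in>B. \<forall>y\<in>B. (x, y) \<in> parcs G \<longrightarrow>
          (x \<in> {v. (u, v) \<in> rtrancl_on B E} \<longleftrightarrow> y \<in> {v. (u, v) \<in> rtrancl_on B E})"
        by (auto simp: E_def elim!: rtrancl_on_into_rtrancl_on)
    qed
    then show "\<forall>v\<in>B. (u, v) \<in> rtrancl_on B E" by blast
  qed
  have closed: "U = B"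
    if c: "\<forall>u\<in>B. \<forall>v\<in>B. (u, v) \<in> rtrancl_on B E" and U: "U \<subseteq> B" "U \<noteq> {}"
      and cl: "\<forall>x\<in>B. \<forall>y\<in>B. (x, y) \<in> parcs G \<longrightarrow> (x \<in> U \<longleftrightarrow> y \<in> U)" for U
  proof -
    obtain u where u: "u \<in> U" using U by auto
    \<comment> \<open>A walk that starts in \<open>U\<close> cannot leave it.\<close>
    have "v \<in> U" if "(u, v) \<in> rtrancl_on B E" for v
      using that by (induction rule: rtrancl_on_induct) (use u cl in \<open>auto simp: E_def\<close>)
    then show ?thesis using c U u by blast
  qed
  show ?thesis unfolding conn
    by (intro conj_cong refl iffI allI impI) (rule closed, assumption+, rule reach, simp)
qed

text \<open>Since no arc joins \<open>U\<close> to \<open>W\<close>, the part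
  \<open>B \<inter> U\<close> is closed under adjacency inside \<open>B\<close>; by connectivity it
  is empty or all of \<open>B\<close>.\<close>

lemma connected_subset_separated:
  assumes "connected_subset G B" "B \<subseteq> U \<union> W"
    and "\<And>u w. u \<in> U \<Longrightarrow> w \<in> W \<Longrightarrow> (u, w) \<notin> parcs G \<and> (w, u) \<notin> parcs G"
    and "U \<inter> W = {}"
  shows "B \<subseteq> U \<or> B \<subseteq> W"
proof (cases "B \<inter> U = {}")
  case False
  have "\<forall>x\<in>B. \<forall>y\<in>B. (x, y) \<in> parcs G \<longrightarrow> (x \<in> B \<inter> U \<longleftrightarrow> y \<in> B \<inter> U)"
    using assms(2-4) by blast
  then have "B \<inter> U = B"
    using assms(1) False unfolding connected_subset_iff by blast
  then show ?thesis by auto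
qed (use assms(2) in auto)

section \<open>Finite orders and their covering relation\<close>

text \<open>Induction on the size of the interval from \<open>x\<close> to \<open>y\<close>: if
  \<open>y\<close> neither equals nor covers \<open>x\<close>, an element \<open>z\<close> strictly
  between them cuts the interval into two strictly smaller ones. Finiteness of \<open>D\<close>
  makes the intervals finite.\<close>

lemma cover_invariant:
  assumes po: "partial_order_on D R" and fin: "finite D"
    and step: "\<And>x y. covers D R y x \<Longrightarrow> P x \<longleftrightarrow> P y"
    and xy: "(x, y) \<in> R"
  shows "P x \<longleftrightarrow> P y"
  using xy
proof (induction "card {z. (x, z) \<in> R \<and> (z, y) \<in> R}" arbitrary: x y rule: less_induct)
  case less
  have R: "R \<subseteq> D \<times> D" "trans R" "antisym R" "refl_on D R"
    using po by (auto dest: partial_order_onD)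
  have finI: "finite {z. (a, z) \<in> R \<and> (z, b) \<in> R}" for a b
    by (rule finite_subset[OF _ fin]) (use R in auto)
  show ?case
  proof (cases "x = y \<or> covers D R y x")
    case True
    then show ?thesis using step by auto
  next
    case False
    then obtain z where z: "(x, z) \<in> R" "x \<noteq> z" "(z, y) \<in> R" "z \<noteq> y"
      using less.prems R(1) by (auto simp: covers_def strictly_below_def)
    have y: "(x, x) \<in> R" "(y, y) \<in> R" using less.prems R(1,4) by (auto simp: refl_on_def)
    have "P x \<longleftrightarrow> P z"
    proof (rule less.hyps[OF psubset_card_mono[OF finI] z(1)])
      \<comment> \<open>By antisymmetry \<open>y\<close> itself drops out of the interval from
        \<open>x\<close> to \<open>z\<close>, which makes the inclusion strict.\<close>
      have "(y, z) \<notin> R" using z R(3) by (auto dest: antisymD)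
      then show "{w. (x, w) \<in> R \<and> (w, z) \<in> R} \<subset> {w. (x, w) \<in> R \<and> (w, y) \<in> R}"
        using z y less.prems transD[OF R(2)] by blast
    qed
    moreover have "P z \<longleftrightarrow> P y"
    proof (rule less.hyps[OF psubset_card_mono[OF finI] z(3)])
      have "(z, x) \<notin> R" using z R(3) by (auto dest: antisymD)
      then show "{w. (z, w) \<in> R \<and> (w, y) \<in> R} \<subset> {w. (x, w) \<in> R \<and> (w, y) \<in> R}"
        using z y less.prems transD[OF R(2)] by blast
    qed
    ultimately show ?thesis by simp
  qed
qed

section \<open>Restriction to an induced subgraph\<close>

text \<open>Kept in \<open>pair_pre_digraph\<close>, so that \<open>staircase_diagram\<close>
  applies to the result.\<close>

definition induced_pair :: "'a pair_pre_digraph \<Rightarrow> 'a set \<Rightarrow> 'a pair_pre_digraph" where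
  "induced_pair G V = \<lparr>pverts = V, parcs = {(x, y) \<in> parcs G. x \<in> V \<and> y \<in> V}\<rparr>"

lemma empty_in_Chains [simp]: "{} \<in> Chains R"
  by (simp add: Chains_def)

lemma saturated_in_trivial [simp]: "saturated_in R C C" "saturated_in R C {}"
  by (auto simp: saturated_in_def)

lemma connected_subset_induced_pair:
  "B \<subseteq> V \<Longrightarrow> connected_subset (induced_pair G V) B \<longleftrightarrow> connected_subset G B"
proof -
  assume "B \<subseteq> V"
  then have "x \<in> B \<Longrightarrow> y \<in> B \<Longrightarrow> (x, y) \<in> parcs (induced_pair G V) \<longleftrightarrow> (x, y) \<in> parcs G" for x y
    by (auto simp: induced_pair_def)
  then show ?thesis unfolding connected_subset_iff by simp
qed

text \<open>All blocks lie in \<open>V\<close>, so connectivity involves only arcs inside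
  \<open>V\<close>. No block passes through a vertex outside \<open>V\<close>: there the chain
  conditions are trivial or reduce to a vertex of \<open>V\<close>, and no block is a minimum or
  maximum.\<close>

lemma staircase_diagram_induced_pair:
  assumes V: "V \<subseteq> pverts G" and D: "\<Union>D \<subseteq> V"
  shows "staircase_diagram (induced_pair G V) D R \<longleftrightarrow> staircase_diagram G D R"
proof -
  have pv: "pverts (induced_pair G V) = V"
    and pa: "parcs (induced_pair G V) = {(x, y) \<in> parcs G. x \<in> V \<and> y \<in> V}"
    by (auto simp: induced_pair_def)
  have e: "blocks_at D s = {}" if "s \<notin> V" for s
    using that D by (auto simp: blocks_at_def)
  have 1: "(\<forall>B\<in>D. B \<noteq> {} \<and> B \<subseteq> V) \<longleftrightarrow> (\<forall>B\<in>D. B \<noteq> {} \<and> B \<subseteq> pverts G)"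
    using V D by blast
  have 2: "(\<forall>B\<in>D. connected_subset (induced_pair G V) B) \<longleftrightarrow> (\<forall>B\<in>D. connected_subset G B)"
    by (intro ball_cong refl connected_subset_induced_pair) (use D in blast)
  have 3: "(\<forall>B B'. covers D R B B' \<longrightarrow> connected_subset (induced_pair G V) (B \<union> B')) \<longleftrightarrow>
      (\<forall>B B'. covers D R B B' \<longrightarrow> connected_subset G (B \<union> B'))"
  proof -
    have "B \<union> B' \<subseteq> V" if "covers D R B B'" for B B'
      using that D by (auto simp: covers_def)
    then show ?thesis by (simp add: connected_subset_induced_pair cong: imp_cong)
  qed
  have 4: "(\<forall>s\<in>V. blocks_at D s \<in> Chains R) \<longleftrightarrow> (\<forall>s\<in>pverts G. blocks_at D s \<in> Chains R)"
    using V e by (metis empty_in_Chains subsetD)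
  have 5: "(\<forall>B\<in>D. (\<exists>s\<in>V. is_minimum R (blocks_at D s) B) \<and> (\<exists>s\<in>V. is_maximum R (blocks_at D s) B))
     \<longleftrightarrow> (\<forall>B\<in>D. (\<exists>s\<in>pverts G. is_minimum R (blocks_at D s) B) \<and>
            (\<exists>s\<in>pverts G. is_maximum R (blocks_at D s) B))"
  proof -
    have "s \<in> V" if "is_minimum R (blocks_at D s) B \<or> is_maximum R (blocks_at D s) B" for s B
      using that e by (force simp: is_minimum_def is_maximum_def)
    then show ?thesis using V by blast
  qed
  let ?Q = "\<lambda>s t. blocks_at D s \<union> blocks_at D t \<in> Chains R \<and>
        saturated_in R (blocks_at D s \<union> blocks_at D t) (blocks_at D s) \<and>
        saturated_in R (blocks_at D s \<union> blocks_at D t) (blocks_at D t)"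
  \<comment> \<open>An arc with an end outside \<open>V\<close> still demands that the blocks at its
    other end form a chain; hence the equivalence is stated under the chain condition at
    vertices.\<close>
  have 6: "(\<forall>(s, t)\<in>parcs (induced_pair G V). ?Q s t) \<longleftrightarrow> (\<forall>(s, t)\<in>parcs G. ?Q s t)"
    if c: "\<forall>s\<in>V. blocks_at D s \<in> Chains R"
  proof -
    have "?Q s t" if "s \<notin> V \<or> t \<notin> V" for s t
    proof -
      have "blocks_at D s = {} \<or> blocks_at D t = {}" using that e by blast
      moreover have "blocks_at D r \<in> Chains R" for r using c e by (cases "r \<in> V") auto
      ultimately show ?thesis by auto
    qed
    then show ?thesis unfolding pa by blast
  qed
  show ?thesis
    unfolding staircase_diagram_def pv 1 2 3 5 4 using 6[unfolded 4] by argo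
qed

section \<open>Disjoint unions of diagrams on separated vertex sets\<close>

text \<open>Every condition is local: it concerns one block, one covering pair, one vertex or one
  arc, and each of these sees blocks from one side only. The conditions for the union are therefore
  the conjunction of those for the two parts.\<close>

lemma staircase_diagram_disjoint_union:
  assumes sub: "\<Union>D1 \<subseteq> U" "\<Union>D2 \<subseteq> W" and UW: "U \<inter> W = {}"
    and sep: "\<And>u w. u \<in> U \<Longrightarrow> w \<in> W \<Longrightarrow> (u, w) \<notin> parcs G \<and> (w, u) \<notin> parcs G"
    and R: "R1 \<subseteq> D1 \<times> D1" "R2 \<subseteq> D2 \<times> D2" and ne: "{} \<notin> D1" "{} \<notin> D2"
  shows "staircase_diagram G (D1 \<union> D2) (R1 \<union> R2) \<longleftrightarrow>
    staircase_diagram G D1 R1 \<and> staircase_diagram G D2 R2"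
proof -
  define D where "D = D1 \<union> D2"
  define R where "R = R1 \<union> R2"
  \<comment> \<open>A common block would lie in \<open>U \<inter> W\<close> and be empty.\<close>
  have disj: "D1 \<inter> D2 = {}"
  proof -
    have False if "B \<in> D1" "B \<in> D2" for B
    proof -
      have "B \<subseteq> U" "B \<subseteq> W" using that sub by auto
      then have "B = {}" using UW by auto
      then show False using ne that by simp
    qed
    then show ?thesis by blast
  qed
  have R1: "(x, y) \<in> R \<longleftrightarrow> (x, y) \<in> R1" if "x \<in> D1 \<or> y \<in> D1" for x y
    using that assms(5,6) disj by (auto simp: R_def)
  have R2: "(x, y) \<in> R \<longleftrightarrow> (x, y) \<in> R2" if "x \<in> D2 \<or> y \<in> D2" for x y
    using that assms(5,6) disj by (auto simp: R_def)
  have cov: "covers D R y x \<longleftrightarrow> covers D1 R1 y x \<or> covers D2 R2 y x" for x y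
    unfolding covers_def strictly_below_def D_def R_def using assms(5,6) disj by blast
  have po: "partial_order_on D R \<longleftrightarrow> partial_order_on D1 R1 \<and> partial_order_on D2 R2"
  proof -
    have 1: "refl_on D R \<longleftrightarrow> refl_on D1 R1 \<and> refl_on D2 R2"
      unfolding refl_on_def D_def R_def using assms(5,6) disj by blast
    have 2: "trans R \<longleftrightarrow> trans R1 \<and> trans R2"
      unfolding trans_def R_def using assms(5,6) disj by blast
    have 3: "antisym R \<longleftrightarrow> antisym R1 \<and> antisym R2"
      unfolding antisym_def R_def using assms(5,6) disj by blast
    have 4: "R \<subseteq> D \<times> D" using assms(5,6) by (auto simp: R_def D_def)
    show ?thesis
      unfolding partial_order_on_def preorder_on_def 1 2 3 using 4 assms(5,6) by blast
  qed
  have b1: "blocks_at D s = blocks_at D1 s \<and> blocks_at D2 s = {}" if "s \<notin> W" for s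
    using that sub by (auto simp: blocks_at_def D_def)
  have b2: "blocks_at D s = blocks_at D2 s \<and> blocks_at D1 s = {}" if "s \<notin> U" for s
    using that sub by (auto simp: blocks_at_def D_def)
  have ch1: "C \<in> Chains R \<longleftrightarrow> C \<in> Chains R1" if "C \<subseteq> D1" for C
    using that R1 unfolding Chains_def by blast
  have ch2: "C \<in> Chains R \<longleftrightarrow> C \<in> Chains R2" if "C \<subseteq> D2" for C
    using that R2 unfolding Chains_def by blast
  have sat1: "saturated_in R P C \<longleftrightarrow> saturated_in R1 P C" if "P \<subseteq> D1" for P C
    using that R1 unfolding saturated_in_def strictly_below_def by blast
  have sat2: "saturated_in R P C \<longleftrightarrow> saturated_in R2 P C" if "P \<subseteq> D2" for P C
    using that R2 unfolding saturated_in_def strictly_below_def by blast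
  have bsub: "blocks_at E s \<subseteq> E" for E :: "'a set set" and s
    by (auto simp: blocks_at_def)
  let ?Q = "\<lambda>D R s t. blocks_at D s \<union> blocks_at D t \<in> Chains R \<and>
        saturated_in R (blocks_at D s \<union> blocks_at D t) (blocks_at D s) \<and>
        saturated_in R (blocks_at D s \<union> blocks_at D t) (blocks_at D t)"
  \<comment> \<open>Both block sets for \<open>D2\<close> are empty here, so its half holds by the
    trivial cases of chains and saturation.\<close>
  have Q1: "?Q D R s t \<longleftrightarrow> ?Q D1 R1 s t \<and> ?Q D2 R2 s t" if "s \<notin> W" "t \<notin> W" for s t
    using b1[OF that(1)] b1[OF that(2)]
    by (simp add: ch1[of "blocks_at D1 s \<union> blocks_at D1 t"] sat1[of "blocks_at D1 s \<union> blocks_at D1 t"] bsub)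
  have Q2: "?Q D R s t \<longleftrightarrow> ?Q D1 R1 s t \<and> ?Q D2 R2 s t" if "s \<notin> U" "t \<notin> U" for s t
    using b2[OF that(1)] b2[OF that(2)]
    by (simp add: ch2[of "blocks_at D2 s \<union> blocks_at D2 t"] sat2[of "blocks_at D2 s \<union> blocks_at D2 t"] bsub)
  \<comment> \<open>Stated by avoidance rather than membership, because \<open>U\<close> and
    \<open>W\<close> need not exhaust the graph: a vertex in neither may have neighbours in
    both.\<close>
  have side: "(s \<notin> W \<and> t \<notin> W) \<or> (s \<notin> U \<and> t \<notin> U)" if "(s, t) \<in> parcs G" for s t
    using that sep[of s t] sep[of t s] UW by blast
  have arcs: "(\<forall>(s, t)\<in>parcs G. ?Q D R s t) \<longleftrightarrow>
      (\<forall>(s, t)\<in>parcs G. ?Q D1 R1 s t) \<and> (\<forall>(s, t)\<in>parcs G. ?Q D2 R2 s t)"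
  proof -
    have "?Q D R s t \<longleftrightarrow> ?Q D1 R1 s t \<and> ?Q D2 R2 s t" if "(s, t) \<in> parcs G" for s t
      using side[OF that] Q1[of s t] Q2[of s t] by argo
    then show ?thesis by fast
  qed
  have verts: "(\<forall>s\<in>pverts G. blocks_at D s \<in> Chains R) \<longleftrightarrow>
      (\<forall>s\<in>pverts G. blocks_at D1 s \<in> Chains R1) \<and> (\<forall>s\<in>pverts G. blocks_at D2 s \<in> Chains R2)"
  proof -
    have "blocks_at D s \<in> Chains R \<longleftrightarrow> blocks_at D1 s \<in> Chains R1 \<and> blocks_at D2 s \<in> Chains R2" for s
    proof (cases "s \<in> W")
      case True
      then have "s \<notin> U" using UW by auto
      then show ?thesis using b2[of s] ch2[OF bsub] by auto
    next
      case False
      then show ?thesis using b1[of s] ch1[OF bsub] by auto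
    qed
    then show ?thesis by blast
  qed
  \<comment> \<open>If \<open>s\<close> is not in \<open>B\<close>, both sides are false; otherwise
    \<open>s\<close> lies in \<open>U\<close>, where only blocks of \<open>D1\<close> occur.\<close>
  have mm1: "is_minimum R (blocks_at D s) B \<longleftrightarrow> is_minimum R1 (blocks_at D1 s) B"
    "is_maximum R (blocks_at D s) B \<longleftrightarrow> is_maximum R1 (blocks_at D1 s) B" if "B \<in> D1" for s B
  proof -
    have "B \<in> blocks_at D s \<longleftrightarrow> B \<in> blocks_at D1 s"
      using that by (auto simp: blocks_at_def D_def)
    moreover have "blocks_at D s = blocks_at D1 s" if "B \<in> blocks_at D1 s"
      using b1[of s] that sub UW by (auto simp: blocks_at_def)
    ultimately show "is_minimum R (blocks_at D s) B \<longleftrightarrow> is_minimum R1 (blocks_at D1 s) B"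
      "is_maximum R (blocks_at D s) B \<longleftrightarrow> is_maximum R1 (blocks_at D1 s) B"
      using R1 that by (auto simp: is_minimum_def is_maximum_def)
  qed
  have mm2: "is_minimum R (blocks_at D s) B \<longleftrightarrow> is_minimum R2 (blocks_at D2 s) B"
    "is_maximum R (blocks_at D s) B \<longleftrightarrow> is_maximum R2 (blocks_at D2 s) B" if "B \<in> D2" for s B
  proof -
    have "B \<in> blocks_at D s \<longleftrightarrow> B \<in> blocks_at D2 s"
      using that by (auto simp: blocks_at_def D_def)
    moreover have "blocks_at D s = blocks_at D2 s" if "B \<in> blocks_at D2 s"
      using b2[of s] that sub UW by (auto simp: blocks_at_def)
    ultimately show "is_minimum R (blocks_at D s) B \<longleftrightarrow> is_minimum R2 (blocks_at D2 s) B"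
      "is_maximum R (blocks_at D s) B \<longleftrightarrow> is_maximum R2 (blocks_at D2 s) B"
      using R2 that by (auto simp: is_minimum_def is_maximum_def)
  qed
  let ?M = "\<lambda>D R. \<forall>B\<in>D. (\<exists>s\<in>pverts G. is_minimum R (blocks_at D s) B) \<and>
             (\<exists>s'\<in>pverts G. is_maximum R (blocks_at D s') B)"
  have mm: "?M D R \<longleftrightarrow> ?M D1 R1 \<and> ?M D2 R2"
    using mm1 mm2 by (simp add: D_def ball_Un)
  have ne': "(\<forall>B\<in>D. B \<noteq> {} \<and> B \<subseteq> pverts G) \<longleftrightarrow>
      (\<forall>B\<in>D1. B \<noteq> {} \<and> B \<subseteq> pverts G) \<and> (\<forall>B\<in>D2. B \<noteq> {} \<and> B \<subseteq> pverts G)"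
    by (simp only: D_def ball_Un)
  have conn: "(\<forall>B\<in>D. connected_subset G B) \<longleftrightarrow>
      (\<forall>B\<in>D1. connected_subset G B) \<and> (\<forall>B\<in>D2. connected_subset G B)"
    by (simp only: D_def ball_Un)
  have conn': "(\<forall>B B'. covers D R B B' \<longrightarrow> connected_subset G (B \<union> B')) \<longleftrightarrow>
      (\<forall>B B'. covers D1 R1 B B' \<longrightarrow> connected_subset G (B \<union> B')) \<and>
      (\<forall>B B'. covers D2 R2 B B' \<longrightarrow> connected_subset G (B \<union> B'))"
    unfolding cov by meson
  have "staircase_diagram G D R \<longleftrightarrow> staircase_diagram G D1 R1 \<and> staircase_diagram G D2 R2"
    unfolding staircase_diagram_def po arcs verts mm ne' conn conn' by argo
  then show ?thesis by (simp add: D_def R_def)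
qed

section \<open>Relabelling vertices along an injection\<close>

definition image_pair :: "('a \<Rightarrow> 'b) \<Rightarrow> 'a pair_pre_digraph \<Rightarrow> 'b pair_pre_digraph" where
  "image_pair f G = \<lparr>pverts = f ` pverts G, parcs = map_prod f f ` parcs G\<rparr>"

lemma map_prod_mem_iff: "inj f \<Longrightarrow> (f x, f y) \<in> map_prod f f ` R \<longleftrightarrow> (x, y) \<in> R"
  by (auto simp: inj_def)

text \<open>The subsets tested by \<open>connected_subset_iff\<close> in an image are themselves
  images, and injectivity transfers membership, equality and arcs.\<close>

lemma connected_subset_image_pair:
  assumes "inj f"
  shows "connected_subset (image_pair f G) (f ` B) \<longleftrightarrow> connected_subset G B"
  unfolding connected_subset_iff all_subset_image
  using assms by (simp add: image_pair_def map_prod_mem_iff inj_image_mem_iff inj_image_eq_iff)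

lemma partial_order_on_image:
  assumes g: "inj g"
  shows "partial_order_on (g ` D) (map_prod g g ` R) \<longleftrightarrow> partial_order_on D R"
proof -
  have sub: "map_prod g g ` R \<subseteq> g ` D \<times> g ` D \<longleftrightarrow> R \<subseteq> D \<times> D"
  proof -
    have "g ` D \<times> g ` D = map_prod g g ` (D \<times> D)" by auto
    then show ?thesis by (simp only: inj_image_subset_iff[OF prod.inj_map[OF g g]])
  qed
  have "refl_on (g ` D) (map_prod g g ` R) \<longleftrightarrow> refl_on D R"
    by (simp add: refl_on_def map_prod_mem_iff[OF g])
  moreover have "trans (map_prod g g ` R) \<longleftrightarrow> trans R"
  proof
    assume t: "trans (map_prod g g ` R)"
    show "trans R"
      by (rule transI) (use transD[OF t] map_prod_mem_iff[OF g] in metis)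
  next
    assume t: "trans R"
    show "trans (map_prod g g ` R)"
      by (rule transI) (use transD[OF t] g in \<open>auto simp: inj_eq\<close>)
  qed
  moreover have "antisym (map_prod g g ` R) \<longleftrightarrow> antisym R"
  proof
    assume t: "antisym (map_prod g g ` R)"
    show "antisym R"
      by (rule antisymI) (use antisymD[OF t] map_prod_mem_iff[OF g] g in \<open>metis inj_eq\<close>)
  next
    assume t: "antisym R"
    show "antisym (map_prod g g ` R)"
      by (rule antisymI) (use antisymD[OF t] g in \<open>auto simp: inj_eq\<close>)
  qed
  ultimately show ?thesis
    unfolding partial_order_on_def preorder_on_def sub by simp
qed

text \<open>The injection on vertices induces an injection \<open>g\<close> on blocks and
  \<open>map_prod g g\<close> on the order; all notions in the definition are both preserved and
  reflected. This serves to shift a later segment of a path back to vertex 1.\<close>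

lemma staircase_diagram_image_pair:
  fixes f :: "'a \<Rightarrow> 'b"
  assumes f: "inj f"
  shows "staircase_diagram (image_pair f G) ((`) f ` D) (map_prod ((`) f) ((`) f) ` R) \<longleftrightarrow>
    staircase_diagram G D R"
proof -
  define g :: "'a set \<Rightarrow> 'b set" where "g = (`) f"
  define R' where "R' = map_prod g g ` R"
  have g: "inj g" using f by (auto simp: g_def inj_def inj_image_eq_iff)
  have R': "(g x, g y) \<in> R' \<longleftrightarrow> (x, y) \<in> R" for x y
    by (simp add: R'_def map_prod_mem_iff[OF g])
  have below: "strictly_below R' (g x) (g y) \<longleftrightarrow> strictly_below R x y" for x y
    by (simp add: strictly_below_def R' inj_eq[OF g])
  have cov: "covers (g ` D) R' (g y) (g x) \<longleftrightarrow> covers D R y x" for x y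
    by (simp add: covers_def below inj_image_mem_iff[OF g])
  have blocks: "blocks_at (g ` D) (f s) = g ` blocks_at D s" for s
    by (auto simp: blocks_at_def g_def inj_eq[OF f])
  have chains: "g ` C \<in> Chains R' \<longleftrightarrow> C \<in> Chains R" for C
    by (simp add: Chains_def R')
  have sat: "saturated_in R' (g ` P) (g ` C) \<longleftrightarrow> saturated_in R P C" for P C
    by (simp add: saturated_in_def below inj_image_subset_iff[OF g] flip: image_set_diff[OF g])
  have mm: "is_minimum R' (g ` C) (g B) \<longleftrightarrow> is_minimum R C B"
    "is_maximum R' (g ` C) (g B) \<longleftrightarrow> is_maximum R C B" for C B
    by (simp_all add: is_minimum_def is_maximum_def R' inj_image_mem_iff[OF g])
  have pv: "pverts (image_pair f G) = f ` pverts G"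
    and pa: "parcs (image_pair f G) = map_prod f f ` parcs G"
    by (simp_all add: image_pair_def)
  have conn: "connected_subset (image_pair f G) (g B) \<longleftrightarrow> connected_subset G B" for B
    by (simp add: g_def connected_subset_image_pair[OF f])
  \<comment> \<open>Here the quantifiers range over all sets, not over the image of
    \<open>D\<close>, so preimages of the two blocks have to be recovered from \<open>covers\<close>
    first.\<close>
  have covers: "(\<forall>B B'. covers (g ` D) R' B B' \<longrightarrow> connected_subset (image_pair f G) (B \<union> B')) \<longleftrightarrow>
      (\<forall>B B'. covers D R B B' \<longrightarrow> connected_subset G (B \<union> B'))" (is "?l \<longleftrightarrow> ?r")
  proof
    assume l: ?l
    show ?r
    proof (intro allI impI)
      fix B B' assume "covers D R B B'"
      then have "connected_subset (image_pair f G) (g B \<union> g B')"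
        using l cov by blast
      then show "connected_subset G (B \<union> B')"
        using conn[of "B \<union> B'"] by (simp add: g_def image_Un)
    qed
  next
    assume r: ?r
    show ?l
    proof (intro allI impI)
      fix B B' assume c: "covers (g ` D) R' B B'"
      then obtain C C' where C: "B = g C" "B' = g C'" by (auto simp: covers_def)
      then have "connected_subset G (C \<union> C')" using r c cov by simp
      then show "connected_subset (image_pair f G) (B \<union> B')"
        using conn[of "C \<union> C'"] C by (simp add: g_def image_Un)
    qed
  qed
  have ne: "g B \<noteq> {} \<and> g B \<subseteq> f ` pverts G \<longleftrightarrow> B \<noteq> {} \<and> B \<subseteq> pverts G" for B
    by (simp add: g_def inj_image_subset_iff[OF f])
  have arcs: "(\<forall>(s, t)\<in>map_prod f f ` parcs G. Q s t) \<longleftrightarrow> (\<forall>(s, t)\<in>parcs G. Q (f s) (f t))" for Q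
    by auto
  have po: "partial_order_on (g ` D) R' \<longleftrightarrow> partial_order_on D R"
    unfolding R'_def by (rule partial_order_on_image[OF g])
  have "staircase_diagram (image_pair f G) (g ` D) R' \<longleftrightarrow> staircase_diagram G D R"
    unfolding staircase_diagram_def pv pa covers arcs po
    by (simp only: ball_simps bex_simps blocks chains sat mm conn ne flip: image_Un)
  then show ?thesis by (simp only: g_def R'_def)
qed

section \<open>Sets of diagrams under restriction and relabelling\<close>

definition diagrams :: "'a pair_pre_digraph \<Rightarrow> ('a set set \<times> 'a set rel) set" where
  "diagrams G = {(D, R). staircase_diagram G D R}"

definition full_diagrams :: "'a pair_pre_digraph \<Rightarrow> ('a set set \<times> 'a set rel) set" where
  "full_diagrams G = {(D, R). staircase_diagram G D R \<and> fully_supported G D}"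

lemma staircase_diagramD:
  assumes "staircase_diagram G D R"
  shows "{} \<notin> D" "D \<subseteq> Pow (pverts G)" "\<Union>D \<subseteq> pverts G" "R \<subseteq> D \<times> D" "partial_order_on D R"
  using assms by (auto simp: staircase_diagram_def dest: partial_order_onD)

text \<open>Turns diagrams on a subgraph into diagrams on \<open>G\<close> with restricted support,
  so that diagrams on two subgraphs can be joined inside one graph.\<close>

lemma diagrams_induced_pair:
  assumes "V \<subseteq> pverts G"
  shows "diagrams (induced_pair G V) = {(D, R). staircase_diagram G D R \<and> \<Union>D \<subseteq> V}"
    "full_diagrams (induced_pair G V) = {(D, R). staircase_diagram G D R \<and> \<Union>D = V}"
proof -
  have eq: "staircase_diagram (induced_pair G V) D R \<longleftrightarrow> staircase_diagram G D R \<and> \<Union>D \<subseteq> V" for D R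
    using staircase_diagramD(3)[of "induced_pair G V" D R] staircase_diagram_induced_pair[OF assms, of D R]
    by (auto simp: induced_pair_def)
  then show "diagrams (induced_pair G V) = {(D, R). staircase_diagram G D R \<and> \<Union>D \<subseteq> V}"
    by (simp add: diagrams_def)
  show "full_diagrams (induced_pair G V) = {(D, R). staircase_diagram G D R \<and> \<Union>D = V}"
    by (auto simp: full_diagrams_def fully_supported_def eq) (auto simp: induced_pair_def)
qed

text \<open>Relabelling acts injectively on pairs of block set and order. It is onto because each
  block of a diagram on the image graph is a subset of the range of \<open>f\<close>, hence an image
  itself.\<close>

lemma card_diagrams_image_pair:
  assumes f: "inj f"
  shows "card (diagrams (image_pair f G)) = card (diagrams G)"
proof -
  define g where "g = (`) f"
  have g: "inj g" using f by (auto simp: g_def inj_def inj_image_eq_iff)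
  have m: "inj (map_prod g g)" by (rule prod.inj_map[OF g g])
  define h where "h = map_prod ((`) g) ((`) (map_prod g g))"
  have h: "inj h"
    unfolding h_def using g m by (intro prod.inj_map injI) (simp_all add: inj_image_eq_iff)
  have "diagrams (image_pair f G) = h ` diagrams G"
  proof (rule set_eqI, rule iffI)
    fix p assume "p \<in> diagrams (image_pair f G)"
    then obtain D R where p: "p = (D, R)" and sd: "staircase_diagram (image_pair f G) D R"
      by (auto simp: diagrams_def)
    have D: "D \<subseteq> g ` UNIV"
    proof
      fix B assume "B \<in> D"
      then have "B \<subseteq> f ` pverts G" using staircase_diagramD(2)[OF sd] by (auto simp: image_pair_def)
      then show "B \<in> g ` UNIV" unfolding g_def by (elim subset_imageE) simp
    qed
    moreover have "R \<subseteq> map_prod g g ` UNIV"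
    proof
      fix q assume "q \<in> R"
      then have "q \<in> g ` UNIV \<times> g ` UNIV"
        using staircase_diagramD(4)[OF sd] D by blast
      then show "q \<in> map_prod g g ` UNIV" by auto
    qed
    ultimately obtain D0 R0 where "D = g ` D0" "R = map_prod g g ` R0"
      by (meson subset_imageE)
    then show "p \<in> h ` diagrams G"
      using sd p staircase_diagram_image_pair[OF f, of G D0 R0]
      by (auto simp: h_def diagrams_def g_def intro!: rev_image_eqI[of "(D0, R0)"])
  next
    fix p assume "p \<in> h ` diagrams G"
    then show "p \<in> diagrams (image_pair f G)"
      using staircase_diagram_image_pair[OF f] by (auto simp: h_def diagrams_def g_def)
  qed
  then show ?thesis using card_image[OF inj_on_subset[OF h]] by simp
qed

section \<open>Splitting a diagram across two separated vertex sets\<close>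

text \<open>Connectivity puts each block, and each union of a covering pair, on one side. Then
  \<open>cover_invariant\<close>, applied to the property of lying in \<open>U\<close>, extends this
  from covering pairs to all comparable pairs.\<close>

lemma staircase_diagram_split:
  assumes sd: "staircase_diagram G D R" and fin: "finite (pverts G)"
    and D: "\<Union>D \<subseteq> U \<union> W" and UW: "U \<inter> W = {}"
    and sep: "\<And>u w. u \<in> U \<Longrightarrow> w \<in> W \<Longrightarrow> (u, w) \<notin> parcs G \<and> (w, u) \<notin> parcs G"
  shows "D = (D \<inter> Pow U) \<union> (D \<inter> Pow W)"
    and "R = (R \<inter> Pow U \<times> Pow U) \<union> (R \<inter> Pow W \<times> Pow W)"
proof -
  have ne: "{} \<notin> D" and RD: "R \<subseteq> D \<times> D" and po: "partial_order_on D R"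
    using staircase_diagramD[OF sd] by auto
  have finD: "finite D"
    using staircase_diagramD(2)[OF sd] fin by (auto intro: finite_subset)
  have side: "B \<subseteq> U \<or> B \<subseteq> W" if "connected_subset G B" "B \<subseteq> \<Union>D" for B
    using that(2) D by (intro connected_subset_separated[OF that(1) _ sep UW]) auto
  have D_side: "B \<subseteq> U \<or> B \<subseteq> W" if "B \<in> D" for B
    using side[of B] sd that by (auto simp: staircase_diagram_def)
  \<comment> \<open>Nonemptiness excludes lying on both sides, so inclusion in \<open>U\<close>
    alone records the side of a block.\<close>
  have excl: "B \<subseteq> U \<longleftrightarrow> \<not> B \<subseteq> W" if "B \<in> D" for B
  proof -
    have "B \<noteq> {}" using that ne by auto
    then show ?thesis using D_side[OF that] UW by auto
  qed
  show "D = (D \<inter> Pow U) \<union> (D \<inter> Pow W)" using D_side by auto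
  have cov: "x \<subseteq> U \<longleftrightarrow> y \<subseteq> U" if c: "covers D R y x" for x y
  proof -
    have "x \<in> D" "y \<in> D" using c by (auto simp: covers_def)
    moreover have "connected_subset G (y \<union> x)" using sd c by (auto simp: staircase_diagram_def)
    ultimately have "y \<union> x \<subseteq> U \<or> y \<union> x \<subseteq> W" by (intro side) auto
    then show ?thesis using excl[OF \<open>x \<in> D\<close>] excl[OF \<open>y \<in> D\<close>] by auto
  qed
  have "x \<in> Pow U \<and> y \<in> Pow U \<or> x \<in> Pow W \<and> y \<in> Pow W" if xy: "(x, y) \<in> R" for x y
  proof -
    have "x \<subseteq> U \<longleftrightarrow> y \<subseteq> U"
      using cover_invariant[where P = "\<lambda>B. B \<subseteq> U", OF po finD cov xy] .
    moreover have "x \<in> D" "y \<in> D" using xy RD by auto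
    ultimately show ?thesis using D_side[of x] D_side[of y] excl[of x] excl[of y] by simp
  qed
  then show "R = (R \<inter> Pow U \<times> Pow U) \<union> (R \<inter> Pow W \<times> Pow W)" by auto
qed

text \<open>Joining and splitting are mutually inverse. A diagram supported in
  \<open>U \<union> W\<close> that covers \<open>U\<close> splits into a part with support exactly
  \<open>U\<close> and an arbitrary part on \<open>W\<close>.\<close>

lemma card_staircase_diagrams_split:
  assumes fin: "finite (pverts G)" and sub: "U \<subseteq> pverts G" "W \<subseteq> pverts G" and UW: "U \<inter> W = {}"
    and sep: "\<And>u w. u \<in> U \<Longrightarrow> w \<in> W \<Longrightarrow> (u, w) \<notin> parcs G \<and> (w, u) \<notin> parcs G"
  shows "card {(D, R). staircase_diagram G D R \<and> U \<subseteq> \<Union>D \<and> \<Union>D \<subseteq> U \<union> W} =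
    card (full_diagrams (induced_pair G U)) * card (diagrams (induced_pair G W))"
proof -
  define join where "join = (\<lambda>((D1, R1), (D2, R2)). (D1 \<union> D2 :: 'a set set, R1 \<union> R2 :: 'a set rel))"
  define split where "split = (\<lambda>(D :: 'a set set, R :: 'a set rel).
     ((D \<inter> Pow U, R \<inter> Pow U \<times> Pow U), (D \<inter> Pow W, R \<inter> Pow W \<times> Pow W)))"
  let ?S = "{(D, R). staircase_diagram G D R \<and> U \<subseteq> \<Union>D \<and> \<Union>D \<subseteq> U \<union> W}"
  let ?F = "full_diagrams (induced_pair G U)" and ?A = "diagrams (induced_pair G W)"
  have "bij_betw join (?F \<times> ?A) ?S"
  proof (rule bij_betw_byWitness[where f' = split])
    show "\<forall>p\<in>?F \<times> ?A. split (join p) = p"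
    proof
      fix p assume "p \<in> ?F \<times> ?A"
      then obtain D1 R1 D2 R2 where p: "p = ((D1, R1), (D2, R2))"
        and 1: "staircase_diagram G D1 R1" "\<Union>D1 = U" and 2: "staircase_diagram G D2 R2" "\<Union>D2 \<subseteq> W"
        by (auto simp: diagrams_induced_pair sub)
      note sd = staircase_diagramD[OF 1(1)] staircase_diagramD[OF 2(1)]
      \<comment> \<open>Only the empty set belongs to both \<open>Pow U\<close> and
        \<open>Pow W\<close>; as it is not a block, intersecting with these recovers the two
        parts.\<close>
      have D1: "B \<subseteq> U \<and> \<not> B \<subseteq> W" if "B \<in> D1" for B
      proof -
        have "B \<noteq> {}" "B \<subseteq> U" using that sd 1(2) by auto
        then show ?thesis using UW by blast
      qed
      have D2: "B \<subseteq> W \<and> \<not> B \<subseteq> U" if "B \<in> D2" for B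
      proof -
        have "B \<noteq> {}" "B \<subseteq> W" using that sd 2(2) by auto
        then show ?thesis using UW by blast
      qed
      have "(D1 \<union> D2) \<inter> Pow U = D1" "(D1 \<union> D2) \<inter> Pow W = D2" using D1 D2 by auto
      moreover have "(R1 \<union> R2) \<inter> Pow U \<times> Pow U = R1" "(R1 \<union> R2) \<inter> Pow W \<times> Pow W = R2"
        using D1 D2 sd(4,9) by auto
      ultimately show "split (join p) = p" by (simp add: p join_def split_def)
    qed
    have S: "join (split p) = p \<and> split p \<in> ?F \<times> ?A" if "p \<in> ?S" for p
    proof -
      obtain D R where p: "p = (D, R)" by (cases p)
      have sd: "staircase_diagram G D R" and UD: "U \<subseteq> \<Union>D" and DUW: "\<Union>D \<subseteq> U \<union> W"
        using that by (simp_all add: p)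
      note eq = staircase_diagram_split[OF sd fin DUW UW sep]
      have "staircase_diagram G ((D \<inter> Pow U) \<union> (D \<inter> Pow W))
          ((R \<inter> Pow U \<times> Pow U) \<union> (R \<inter> Pow W \<times> Pow W))"
        using sd eq by metis
      moreover have "staircase_diagram G ((D \<inter> Pow U) \<union> (D \<inter> Pow W))
          ((R \<inter> Pow U \<times> Pow U) \<union> (R \<inter> Pow W \<times> Pow W)) \<longleftrightarrow>
        staircase_diagram G (D \<inter> Pow U) (R \<inter> Pow U \<times> Pow U) \<and>
        staircase_diagram G (D \<inter> Pow W) (R \<inter> Pow W \<times> Pow W)"
        using staircase_diagramD(1,4)[OF sd]
        by (intro staircase_diagram_disjoint_union[OF _ _ UW sep]) auto
      \<comment> \<open>A block through a vertex of \<open>U\<close> cannot lie in \<open>W\<close>,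
        so it lies in \<open>U\<close> and survives the intersection.\<close>
      moreover have "\<Union>(D \<inter> Pow U) = U"
      proof
        show "U \<subseteq> \<Union>(D \<inter> Pow U)"
        proof
          fix u assume u: "u \<in> U"
          then obtain B where B: "B \<in> D" "u \<in> B" using UD by auto
          then have "\<not> B \<subseteq> W" using u UW by auto
          then have "B \<subseteq> U" using B(1) eq(1) by auto
          then show "u \<in> \<Union>(D \<inter> Pow U)" using B by auto
        qed
      qed auto
      moreover have "\<Union>(D \<inter> Pow W) \<subseteq> W" by auto
      ultimately show ?thesis
        using eq by (simp add: p join_def split_def diagrams_induced_pair sub)
    qed
    show "\<forall>p\<in>?S. join (split p) = p" using S by blast
    show "split ` ?S \<subseteq> ?F \<times> ?A" using S by blast
    show "join ` (?F \<times> ?A) \<subseteq> ?S"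
    proof
      fix q assume "q \<in> join ` (?F \<times> ?A)"
      then obtain D1 R1 D2 R2 where q: "q = (D1 \<union> D2, R1 \<union> R2)"
        and 1: "staircase_diagram G D1 R1" "\<Union>D1 = U" and 2: "staircase_diagram G D2 R2" "\<Union>D2 \<subseteq> W"
        by (auto simp: diagrams_induced_pair sub join_def)
      have "staircase_diagram G (D1 \<union> D2) (R1 \<union> R2)"
        using 1 2 staircase_diagramD(1,4)[OF 1(1)] staircase_diagramD(1,4)[OF 2(1)]
        by (subst staircase_diagram_disjoint_union[OF _ _ UW sep]) auto
      then show "q \<in> ?S" using 1(2) 2(2) by (auto simp: q)
    qed
  qed
  then have "card ?S = card (?F \<times> ?A)" by (simp add: bij_betw_same_card)
  then show ?thesis by (simp add: card_cartesian_product)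
qed

section \<open>The recurrence for paths\<close>

lemma num_staircase_eq: "num_staircase n = card (diagrams (path_graph n))"
  by (simp add: num_staircase_def diagrams_def)

lemma num_full_staircase_eq: "num_full_staircase n = card (full_diagrams (path_graph n))"
  by (simp add: num_full_staircase_def full_diagrams_def)

lemma num_full_staircase_0: "num_full_staircase 0 = 1"
proof -
  have "full_diagrams (path_graph 0) = diagrams (path_graph 0)"
    using staircase_diagramD(3)[of "path_graph 0"]
    by (fastforce simp: full_diagrams_def diagrams_def fully_supported_def path_graph_def)
  then show ?thesis
    by (metis num_staircase_0 num_staircase_eq num_full_staircase_eq)
qed

text \<open>If \<open>k < l\<close>, then \<open>Suc k\<close> lies in \<open>{1..l}\<close> and
  would be covered. This makes the classes by first uncovered vertex disjoint.\<close>

lemma first_uncovered_unique: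
  assumes "{1..k::nat} \<subseteq> X" "Suc k \<notin> X" "{1..l} \<subseteq> X" "Suc l \<notin> X"
  shows "k = l"
proof (rule ccontr)
  assume "k \<noteq> l"
  then consider "Suc k \<in> {1..l}" | "Suc l \<in> {1..k}" by (cases k l rule: linorder_cases) auto
  then show False using assms by cases blast+
qed

text \<open>A diagram that is not fully supported has a first uncovered vertex \<open>Suc k\<close>
  with \<open>k < n\<close>. The \<open>k\<close> vertices before it carry a fully supported
  diagram, the \<open>n - Suc k\<close> vertices after it an arbitrary one; either segment may be
  empty, and then contributes the factor 1.\<close>

lemma num_staircase_rec:
  "num_staircase n = num_full_staircase n + (\<Sum>k<n. num_full_staircase k * num_staircase (n - Suc k))"
proof -
  let ?G = "path_graph n"
  define S where "S k = {(D, R). staircase_diagram ?G D R \<and> {1..k} \<subseteq> \<Union>D \<and> Suc k \<notin> \<Union>D}" for k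
  have pv: "pverts ?G = {1..n}" by (simp add: path_graph_def)
  have fin: "finite (diagrams ?G)"
    unfolding diagrams_def by (rule finite_staircase_diagrams) (simp add: pv)
  have card_S: "card (S k) = num_full_staircase k * num_staircase (n - Suc k)" if k: "k < n" for k
  proof -
    \<comment> \<open>Omitting \<open>Suc k\<close> leaves no arc between the two segments.\<close>
    let ?U = "{1..k}" and ?W = "{Suc (Suc k)..n}"
    have UW: "{1..n} - {Suc k} = ?U \<union> ?W" using k by auto
    have "\<Union>D \<subseteq> ?U \<union> ?W \<longleftrightarrow> Suc k \<notin> \<Union>D" if "staircase_diagram ?G D R" for D R
      using staircase_diagramD(3)[OF that] unfolding pv UW[symmetric] by blast
    then have "S k = {(D, R). staircase_diagram ?G D R \<and> ?U \<subseteq> \<Union>D \<and> \<Union>D \<subseteq> ?U \<union> ?W}"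
      unfolding S_def by blast
    also have "card \<dots> = card (full_diagrams (induced_pair ?G ?U)) * card (diagrams (induced_pair ?G ?W))"
      by (rule card_staircase_diagrams_split) (use k in \<open>auto simp: path_graph_def\<close>)
    also have "induced_pair ?G ?U = path_graph k"
      using k by (auto simp: induced_pair_def path_graph_def)
    also have "induced_pair ?G ?W = image_pair ((+) (Suc k)) (path_graph (n - Suc k))"
    proof -
      have W: "?W = (+) (Suc k) ` {1..n - Suc k}"
        using k by (simp only: image_add_atLeastAtMost) simp
      have "{(x, y) \<in> parcs ?G. x \<in> ?W \<and> y \<in> ?W} =
          map_prod ((+) (Suc k)) ((+) (Suc k)) ` parcs (path_graph (n - Suc k))"
      proof (rule set_eqI, rule iffI)
        fix p assume "p \<in> {(x, y) \<in> parcs ?G. x \<in> ?W \<and> y \<in> ?W}"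
        \<comment> \<open>The truncated subtraction is exact, since both entries exceed
          \<open>Suc k\<close>.\<close>
        then show "p \<in> map_prod ((+) (Suc k)) ((+) (Suc k)) ` parcs (path_graph (n - Suc k))"
          by (intro image_eqI[where x = "(fst p - Suc k, snd p - Suc k)"]) (auto simp: path_graph_def)
      qed (auto simp: path_graph_def)
      then show ?thesis
        using W by (simp add: induced_pair_def image_pair_def) (simp add: path_graph_def)
    qed
    also have "card (diagrams (image_pair ((+) (Suc k)) (path_graph (n - Suc k)))) =
        num_staircase (n - Suc k)"
      by (simp add: card_diagrams_image_pair num_staircase_eq)
    finally show ?thesis by (simp add: num_full_staircase_eq)
  qed
  have "p \<in> (\<Union>k<n. S k)" if p: "p \<in> diagrams ?G" "p \<notin> full_diagrams ?G" for p
  proof -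
    obtain D R where DR: "p = (D, R)" "staircase_diagram ?G D R"
      using p by (auto simp: diagrams_def)
    have ex: "\<exists>v. v \<in> {1..n} - \<Union>D"
      using p DR staircase_diagramD(3)[OF DR(2)]
      by (auto simp: full_diagrams_def fully_supported_def pv)
    \<comment> \<open>The class index is \<open>v - 1\<close>; as vertices start at 1,
      \<open>Suc (v - 1)\<close> is \<open>v\<close> again.\<close>
    define v where "v = (LEAST v. v \<in> {1..n} - \<Union>D)"
    have v: "v \<in> {1..n} - \<Union>D" unfolding v_def by (rule LeastI_ex[OF ex])
    have v_bounds: "1 \<le> v" "v \<le> n" using v by auto
    have "u \<in> \<Union>D" if u: "u \<in> {1..v - 1}" for u
    proof -
      have "u < v" using u v_bounds by auto
      then have "u \<notin> {1..n} - \<Union>D" unfolding v_def by (rule not_less_Least)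
      moreover have "u \<in> {1..n}" using u v_bounds by auto
      ultimately show ?thesis by blast
    qed
    then have "{1..v - 1} \<subseteq> \<Union>D" by (rule subsetI)
    moreover have "Suc (v - 1) \<notin> \<Union>D" using v v_bounds by simp
    ultimately have "p \<in> S (v - 1)" using DR by (simp add: S_def)
    moreover have "v - 1 < n" using v_bounds by simp
    ultimately show ?thesis by blast
  qed
  moreover have "S k \<subseteq> diagrams ?G" for k by (auto simp: S_def diagrams_def)
  moreover have "full_diagrams ?G \<subseteq> diagrams ?G" by (auto simp: full_diagrams_def diagrams_def)
  ultimately have eq: "diagrams ?G = full_diagrams ?G \<union> (\<Union>k<n. S k)"
    by blast
  have fin_S: "finite (S k)" for k
    by (rule finite_subset[OF _ fin]) (auto simp: S_def diagrams_def)
  \<comment> \<open>For \<open>k < n\<close> the uncovered \<open>Suc k\<close> is a vertex of the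
    graph, which rules out full support.\<close>
  have disj: "full_diagrams ?G \<inter> (\<Union>k<n. S k) = {}"
    by (auto simp: S_def full_diagrams_def fully_supported_def pv)
  have "S k \<inter> S l = {}" if "k \<noteq> l" for k l
    using first_uncovered_unique that by (auto simp: S_def)
  then have "card (\<Union>k<n. S k) = (\<Sum>k<n. card (S k))"
    using fin_S by (intro card_UN_disjoint) auto
  then have "card (diagrams ?G) = card (full_diagrams ?G) + (\<Sum>k<n. card (S k))"
    using disj fin eq fin_S by (metis card_Un_disjoint finite_Un)
  then show ?thesis
    by (simp add: num_staircase_eq num_full_staircase_eq card_S[unfolded num_staircase_eq num_full_staircase_eq])
qed

section \<open>From the recurrence to generating functions\<close>

theorem theorem8p4:
  shows "staircase_gf =
    (1 + full_staircase_gf) / (1 - fps_X - fps_X * full_staircase_gf)"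
proof -
  \<comment> \<open>The summand 1 restores the empty diagram on no vertices, so the coefficient
    formula holds at 0 too. The denominator of the claim is \<open>1 - fps_X * F\<close>.\<close>
  define F where "F = 1 + full_staircase_gf"
  have F: "fps_nth F k = of_nat (num_full_staircase k)" for k
    by (simp add: F_def full_staircase_gf_def num_full_staircase_0)
  have "staircase_gf = F + fps_X * (F * staircase_gf)"
  proof (rule fps_ext)
    fix n
    show "fps_nth staircase_gf n = fps_nth (F + fps_X * (F * staircase_gf)) n"
    proof (cases n)
      case 0
      then show ?thesis
        by (simp add: F staircase_gf_def num_staircase_0 num_full_staircase_0)
    next
      case (Suc m)
      have "fps_nth staircase_gf n = of_nat (num_staircase n)" by (simp add: staircase_gf_def)
      also have "\<dots> = fps_nth F n + (\<Sum>k<n. fps_nth F k * of_nat (num_staircase (n - Suc k)))"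
        by (subst num_staircase_rec) (simp add: F)
      \<comment> \<open>The factor \<open>fps_X\<close> lowers the index to \<open>m\<close>, and
        \<open>n - Suc k\<close> equals \<open>m - k\<close>, so the sum is the Cauchy product at
        \<open>m\<close>.\<close>
      also have "\<dots> = fps_nth (F + fps_X * (F * staircase_gf)) n"
        by (simp add: Suc fps_mult_nth[of F] staircase_gf_def atLeast0AtMost lessThan_Suc_atMost)
      finally show ?thesis .
    qed
  qed
  then have eq: "staircase_gf * (1 - fps_X * F) = F" by (simp add: algebra_simps)
  \<comment> \<open>The constant term is 1, so the divisor is nonzero and can be cancelled in
    \<open>eq\<close>.\<close>
  have "fps_nth (1 - fps_X * F) 0 \<noteq> 0" by simp
  then have "1 - fps_X * F \<noteq> 0" by (metis fps_zero_nth)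
  then have "F / (1 - fps_X * F) = staircase_gf"
    by (metis eq nonzero_mult_div_cancel_right)
  then show ?thesis by (simp add: F_def algebra_simps)
qed

end
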